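(* Let $p$ be an odd prime, $n$ a positive integer, and let $S$ be a commutative $p$-scheme on $X$ of order $p^n$ such that $n_{\mathbf{O}_{\theta}(S)} = p^{n-1}$. Then $S$ is schurian.
   Context: Let $X$ be a nonempty finite set and $S$ a partition of $X\times X$. $S$ is an association scheme (scheme) on $X$ if: (i) $1_X := \{(x,x) \mid x\in X\} \in S$; (ii) for each $s\in S$, $s^* := \{(x,y) \mid (y,x)\in s\} \in S$; (iii) for all $s,t,u\in S$ and $x,y \in X$, the number $a_{stu} := |xs\cap yt^*|$ is constant whenever $(x,y)\in u$, where $xs := \{y\in X \mid (x,y)\in s\}$. $S$ is commutative if $a_{stu}=a_{tsu}$ for all $s,t,u\in S$. The valency of $s\in S$ is $n_s := a_{ss^*1_X}$ (so $n_s=|xs|$ for every $x \in X$); for $U\subseteq S$ the order of $U$ is $n_U := \sum_{u\in U} n_u$. Thus the order of $S$ is $n_S=|X|$. For a prime $p$, $S$ is a $p$-scheme if $|X|$ and all valencies $n_s$ ($s\in S$) are powers of $p$ (with $1=p^0$ allowed). The thin radical of $S$ is $\mathbf{O}_{\theta}(S) := \{s\in S \mid n_s=1\}$. $S$ is schurian if there is a transitive permutation group $G$ on $X$ such that $S$ is the set of orbits of $G$ acting componentwise on $X\times X$. *)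

theory Defs
  imports
    "HOL-Library.Disjoint_Sets"
    "HOL-Computational_Algebra.Primes"
    "HOL-Algebra.Group_Action"
begin

text \<open>
  A relation \<open>s \<subseteq> X \<times> X\<close> is a set of pairs: \<open>s\<^sup>*\<close> is the library's \<open>s\<inverse>\<close>, the set
  \<open>xs\<close> is \<open>s `` {x}\<close>, and \<open>1\<^sub>X\<close> is \<open>Id_on X\<close>.
\<close>

locale association_scheme =
  fixes X :: "'a set" and S :: "('a \<times> 'a) set set"
  assumes finite_points: "finite X"
    and points_nonempty: "X \<noteq> {}"
    and partition: "partition_on (X \<times> X) S"
    and identity_mem: "Id_on X \<in> S"
    and converse_mem: "s \<in> S \<Longrightarrow> s\<inverse> \<in> S"
    and regular: "s \<in> S \<Longrightarrow> t \<in> S \<Longrightarrow> u \<in> S \<Longrightarrow>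
      \<exists>c. \<forall>(x, y) \<in> u. card (s `` {x} \<inter> t\<inverse> `` {y}) = c"

text \<open>
  The structure constant \<open>a\<^bsub>stu\<^esub>\<close>. The description is unique whenever \<open>u\<close> is nonempty and the
  cardinality is constant on \<open>u\<close>, in particular for \<open>s, t, u\<close> in a scheme.
\<close>

definition structure_constant ::
    "('a \<times> 'a) set \<Rightarrow> ('a \<times> 'a) set \<Rightarrow> ('a \<times> 'a) set \<Rightarrow> nat" where
  "structure_constant s t u =
     (THE c. \<forall>(x, y) \<in> u. card (s `` {x} \<inter> t\<inverse> `` {y}) = c)"

definition commutative_scheme :: "'a set \<Rightarrow> ('a \<times> 'a) set set \<Rightarrow> bool" where
  "commutative_scheme X S \<longleftrightarrow> association_scheme X S \<and>
     (\<forall>s \<in> S. \<forall>t \<in> S. \<forall>u \<in> S. structure_constant s t u = structure_constant t s u)"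

definition valency :: "'a set \<Rightarrow> ('a \<times> 'a) set \<Rightarrow> nat" where
  "valency X s = structure_constant s (s\<inverse>) (Id_on X)"

definition scheme_order :: "'a set \<Rightarrow> ('a \<times> 'a) set set \<Rightarrow> nat" where
  "scheme_order X U = (\<Sum>u\<in>U. valency X u)"

definition p_scheme :: "nat \<Rightarrow> 'a set \<Rightarrow> ('a \<times> 'a) set set \<Rightarrow> bool" where
  "p_scheme p X S \<longleftrightarrow> prime p \<and> association_scheme X S \<and>
     (\<exists>k. card X = p ^ k) \<and> (\<forall>s \<in> S. \<exists>k. valency X s = p ^ k)"

definition thin_radical :: "'a set \<Rightarrow> ('a \<times> 'a) set set \<Rightarrow> ('a \<times> 'a) set set" where
  "thin_radical X S = {s \<in> S. valency X s = 1}"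

text \<open>
  A permutation group on \<open>X\<close> is a subgroup \<open>G\<close> of \<open>BijGroup X\<close>, acting on \<open>X\<close> by evaluation.
  The componentwise action is restricted to \<open>X \<times> X\<close> because \<open>BijGroup\<close> consists of
  extensional functions.
\<close>

definition schurian :: "'a set \<Rightarrow> ('a \<times> 'a) set set \<Rightarrow> bool" where
  "schurian X S \<longleftrightarrow>
     (\<exists>G. subgroup G (BijGroup X) \<and>
          transitive_action (BijGroup X\<lparr>carrier := G\<rparr>) X (\<lambda>g. g) \<and>
          S = orbits (BijGroup X\<lparr>carrier := G\<rparr>) (X \<times> X)
                (\<lambda>g. restrict (map_prod g g) (X \<times> X)))"

lemma permutation_group_action:
  assumes "subgroup G (BijGroup X)"
  shows "group_action (BijGroup X\<lparr>carrier := G\<rparr>) X (\<lambda>g. g)"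
proof -
  interpret group "BijGroup X" by (rule group_BijGroup)
  have "group (BijGroup X\<lparr>carrier := G\<rparr>)"
    using assms by (rule subgroup_imp_group)
  moreover have "(\<lambda>g. g) \<in> hom (BijGroup X\<lparr>carrier := G\<rparr>) (BijGroup X)"
    using subgroup.subset[OF assms] by (auto simp: hom_def)
  ultimately show ?thesis
    by (intro group_action.intro group_hom.intro group_hom_axioms.intro group_BijGroup)
qed

lemma schurian_iff:
  "schurian X S \<longleftrightarrow>
     (\<exists>G. subgroup G (BijGroup X) \<and>
          (\<forall>x\<in>X. \<forall>y\<in>X. \<exists>g\<in>G. g x = y) \<and>
          S = {{(g x, g y) | g. g \<in> G} | x y. x \<in> X \<and> y \<in> X})"
proof -
  have trans: "transitive_action (BijGroup X\<lparr>carrier := G\<rparr>) X (\<lambda>g. g) \<longleftrightarrow>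
      (\<forall>x\<in>X. \<forall>y\<in>X. \<exists>g\<in>G. g x = y)" if "subgroup G (BijGroup X)" for G
    using permutation_group_action[OF that]
    by (auto simp: transitive_action_def transitive_action_axioms_def)
  have orb: "orbits (BijGroup X\<lparr>carrier := G\<rparr>) (X \<times> X)
      (\<lambda>g. restrict (map_prod g g) (X \<times> X)) =
      {{(g x, g y) | g. g \<in> G} | x y. x \<in> X \<and> y \<in> X}" for G
  proof -
    have "orbit (BijGroup X\<lparr>carrier := G\<rparr>)
        (\<lambda>g. restrict (map_prod g g) (X \<times> X)) (x, y) = {(g x, g y) | g. g \<in> G}"
      if "x \<in> X" "y \<in> X" for x y
      using that by (auto simp: orbit_def)
    then show ?thesis unfolding orbits_def by (fastforce simp: set_eq_iff)
  qed
  show ?thesis unfolding schurian_def orb using trans by blast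
qed

context association_scheme
begin

lemma structure_constant_eq:
  assumes "s \<in> S" "t \<in> S" "u \<in> S" "(x, y) \<in> u"
  shows "structure_constant s t u = card (s `` {x} \<inter> t\<inverse> `` {y})"
proof -
  obtain c where c: "\<forall>(x, y) \<in> u. card (s `` {x} \<inter> t\<inverse> `` {y}) = c"
    using regular assms by blast
  have "structure_constant s t u = c"
    unfolding structure_constant_def using c assms(4) by (intro the_equality) auto
  then show ?thesis using c assms(4) by auto
qed

lemma valency_eq_card:
  assumes "s \<in> S" "x \<in> X"
  shows "valency X s = card (s `` {x})"
  unfolding valency_def
  using structure_constant_eq[OF assms(1) converse_mem[OF assms(1)] identity_mem, of x x] assms(2)
  by (simp add: Id_on_iff)

lemma scheme_order_eq_card: "scheme_order X S = card X"
proof -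
  obtain x where x: "x \<in> X" using points_nonempty by blast
  have U: "\<Union>S = X \<times> X" and dis: "disjoint S"
    using partition by (auto simp: partition_on_def)
  have fin: "finite S"
    using finite_elements[OF _ partition] finite_points by blast
  have sub: "s `` {x} \<subseteq> X" if "s \<in> S" for s using U that by blast
  have "scheme_order X S = (\<Sum>s\<in>S. card (s `` {x}))"
    unfolding scheme_order_def by (intro sum.cong refl valency_eq_card x)
  also have "\<dots> = card (\<Union>s\<in>S. s `` {x})"
  proof (rule card_UN_disjoint[symmetric, OF fin])
    show "\<forall>i\<in>S. finite (i `` {x})" using sub finite_points finite_subset by blast
    show "\<forall>i\<in>S. \<forall>j\<in>S. i \<noteq> j \<longrightarrow> i `` {x} \<inter> j `` {x} = {}"
      using dis by (fastforce simp: disjoint_def)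
  qed
  also have "(\<Union>s\<in>S. s `` {x}) = X" using U x by blast
  finally show ?thesis .
qed

end

end

theory Submission
  imports Defs
begin

text \<open>
  The thin radical \<open>T\<close> is a group acting semiregularly on \<open>X\<close>, with \<open>p\<close> classes \<open>xT\<close>, and each set
  \<open>xs\<close> lies in a single class. Hence \<open>xs\<close> is an orbit of the subgroup \<open>H\<^sub>s = {t \<in> T. st = s}\<close>.
  Commutativity makes \<open>T\<close> act by automorphisms and gives \<open>H\<^sub>w \<subseteq> H\<^sub>u H\<^sub>v\<close> for \<open>w \<in> uv\<close>. As \<open>X\<close>
  has only \<open>p\<close> classes, all \<open>H\<^sub>s\<close> with \<open>s \<notin> T\<close> are then the same group \<open>H\<close>. So the relation of
  two points in different classes depends only on their relations to a third point and is unchanged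
  when the points move within their \<open>H\<close>-orbits, independently in each class. This freedom yields
  enough automorphisms for them to be transitive on each relation.
\<close>

context association_scheme
begin

section \<open>Elementary facts on the relations of a scheme\<close>

lemma finite_scheme: "finite S"
  using finite_elements[OF _ partition] finite_points by blast

lemma relation_subset: "s \<in> S \<Longrightarrow> s \<subseteq> X \<times> X"
  using partition by (auto simp: partition_on_def)

lemma relation_points: "s \<in> S \<Longrightarrow> (x, y) \<in> s \<Longrightarrow> x \<in> X \<and> y \<in> X"
  using relation_subset by blast

lemma finite_Image: "s \<in> S \<Longrightarrow> finite (s `` A)"
  by (rule finite_subset[OF Image_subset finite_points]) (rule relation_subset)

lemma relation_nonempty: "s \<in> S \<Longrightarrow> \<exists>x y. (x, y) \<in> s"
  using partition by (auto simp: partition_on_def) (metis ex_in_conv surj_pair)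

lemma relation_unique: "s \<in> S \<Longrightarrow> t \<in> S \<Longrightarrow> (x, y) \<in> s \<Longrightarrow> (x, y) \<in> t \<Longrightarrow> s = t"
  using partition by (auto simp: partition_on_def disjoint_def)

lemma relation_exists: "x \<in> X \<Longrightarrow> y \<in> X \<Longrightarrow> \<exists>s\<in>S. (x, y) \<in> s"
proof -
  assume "x \<in> X" "y \<in> X"
  then have "(x, y) \<in> \<Union>S" using partition by (simp add: partition_on_def)
  then show ?thesis by blast
qed

text \<open>The number of middle points is the structure constant of \<open>s\<close>,
  \<open>t\<close> over \<open>u\<close>. One triangle over a pair of \<open>u\<close> makes it
  nonzero, so every pair of \<open>u\<close> carries a triangle.\<close>

lemma triangle_transfer:
  assumes "s \<in> S" "t \<in> S" "u \<in> S"
    and "(x, y) \<in> s" "(y, z) \<in> t" "(x, z) \<in> u" "(x', z') \<in> u"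
  shows "\<exists>y'. (x', y') \<in> s \<and> (y', z') \<in> t"
proof -
  have "card (s `` {x} \<inter> t\<inverse> `` {z}) = card (s `` {x'} \<inter> t\<inverse> `` {z'})"
    using structure_constant_eq[OF assms(1-3)] assms(6,7) by metis
  moreover have "card (s `` {x} \<inter> t\<inverse> `` {z}) \<noteq> 0"
    using assms(4,5) finite_Image[OF assms(1)] by auto
  ultimately have "s `` {x'} \<inter> t\<inverse> `` {z'} \<noteq> {}" by (metis card.empty)
  then show ?thesis by blast
qed

text \<open>The degenerate triangle \<open>x'\<close>, \<open>y'\<close>, \<open>x'\<close> over the
  identity relation is transferred to the identity pair at \<open>x\<close>.\<close>

lemma relation_total:
  assumes s: "s \<in> S" and x: "x \<in> X"
  shows "\<exists>y. (x, y) \<in> s"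
proof -
  obtain x' y' where x'y': "(x', y') \<in> s" using relation_nonempty[OF s] by blast
  have "(x', x') \<in> Id_on X" "(x, x) \<in> Id_on X" using x relation_points[OF s x'y'] by auto
  then show ?thesis
    using triangle_transfer[OF s converse_mem[OF s] identity_mem x'y'] x'y' by blast
qed

lemma card_Image_Union:
  assumes "D \<subseteq> S"
  shows "card ((\<Union>D) `` {x} \<inter> A) = (\<Sum>u\<in>D. card (u `` {x} \<inter> A))"
proof -
  have "(\<Union>D) `` {x} \<inter> A = (\<Union>u\<in>D. u `` {x} \<inter> A)" by blast
  also have "card \<dots> = (\<Sum>u\<in>D. card (u `` {x} \<inter> A))"
  proof (rule card_UN_disjoint)
    show "finite D" using assms finite_scheme finite_subset by blast
    show "\<forall>u\<in>D. finite (u `` {x} \<inter> A)" using assms finite_Image by blast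
    show "\<forall>u\<in>D. \<forall>v\<in>D. u \<noteq> v \<longrightarrow> (u `` {x} \<inter> A) \<inter> (v `` {x} \<inter> A) = {}"
      using assms relation_unique by blast
  qed
  finally show ?thesis .
qed

lemma card_Image_Union_eq_scheme_order:
  assumes "D \<subseteq> S" "x \<in> X"
  shows "card ((\<Union>D) `` {x}) = scheme_order X D"
  using card_Image_Union[OF assms(1), of x UNIV] valency_eq_card assms
  by (auto simp: scheme_order_def intro!: sum.cong)

text \<open>Lagrange's theorem for a closed subset \<open>D\<close>: every class has as many points
  as the order of \<open>D\<close>.\<close>

lemma scheme_order_mult_card_quotient:
  assumes "D \<subseteq> S" "equiv X (\<Union>D)"
  shows "scheme_order X D * card (X // \<Union>D) = card X"
proof -
  have fin: "finite (X // \<Union>D)"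
    using equiv_type[OF assms(2)] finite_quotient finite_points by blast
  have card_class: "card C = scheme_order X D" if "C \<in> X // \<Union>D" for C
    using that card_Image_Union_eq_scheme_order[OF assms(1)] by (auto elim!: quotientE)
  have disj: "C \<inter> C' = {}" if "C \<in> X // \<Union>D" "C' \<in> X // \<Union>D" "C \<noteq> C'" for C C'
    using quotient_disj[OF assms(2)] that by blast
  have "scheme_order X D * card (X // \<Union>D) = card (\<Union>(X // \<Union>D))"
    by (rule card_partition[OF fin _ card_class disj])
      (simp_all add: Union_quotient[OF assms(2)] finite_points)
  then show ?thesis by (simp add: Union_quotient[OF assms(2)])
qed

section \<open>The thin radical as a group\<close>

abbreviation T :: "('a \<times> 'a) set set" where "T \<equiv> thin_radical X S"

lemma thin_mem: "t \<in> T \<Longrightarrow> t \<in> S"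
  by (simp add: thin_radical_def)

lemma thin_iff:
  assumes "t \<in> S" "x \<in> X"
  shows "t \<in> T \<longleftrightarrow> card (t `` {x}) = 1"
  using assms valency_eq_card by (simp add: thin_radical_def)

lemma thin_image:
  assumes "t \<in> T" "x \<in> X"
  obtains y where "t `` {x} = {y}"
  using thin_iff[OF thin_mem] assms by (metis card_1_singletonE)

lemma thin_functional: "t \<in> T \<Longrightarrow> (x, y) \<in> t \<Longrightarrow> (x, z) \<in> t \<Longrightarrow> y = z"
  by (metis Image_singleton_iff relation_points singletonD thin_image thin_mem)

lemma thin_total: "t \<in> T \<Longrightarrow> x \<in> X \<Longrightarrow> \<exists>y\<in>X. (x, y) \<in> t"
  by (metis Image_singleton_iff insertI1 relation_points thin_image thin_mem)

lemma identity_thin: "Id_on X \<in> T"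
  using identity_mem points_nonempty by (auto simp: thin_iff)

text \<open>A thin relation is the graph of a map \<open>f\<close> on \<open>X\<close>. The valency
  of the converse is the same at every point and positive somewhere, so \<open>f\<close> is
  surjective; finiteness makes it injective, and preimages are singletons.\<close>

lemma thin_converse:
  assumes t: "t \<in> T"
  shows "t\<inverse> \<in> T"
proof -
  have tS: "t \<in> S" "t\<inverse> \<in> S" using t thin_mem converse_mem by auto
  obtain f where f: "(x, f x) \<in> t" if "x \<in> X" for x
    using thin_total[OF t] by metis
  have fX: "f ` X \<subseteq> X" using f relation_points[OF tS(1)] by blast
  have "\<exists>x\<in>X. y = f x" if y: "y \<in> X" for y
  proof -
    obtain x z where xz: "(x, z) \<in> t" using relation_nonempty[OF tS(1)] by blast
    then have "t\<inverse> `` {z} \<noteq> {}" by blast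
    then have "card (t\<inverse> `` {z}) \<noteq> 0" using finite_Image[OF tS(2)] by simp
    then have "card (t\<inverse> `` {y}) \<noteq> 0"
      using valency_eq_card[OF tS(2)] y xz relation_points[OF tS(1)] by metis
    then have "t\<inverse> `` {y} \<noteq> {}" by (metis card.empty)
    then obtain x where "(x, y) \<in> t" by blast
    then show ?thesis using f thin_functional[OF t] relation_points[OF tS(1)] by blast
  qed
  then have "f ` X = X" using fX by blast
  then have inj: "inj_on f X" using finite_points eq_card_imp_inj_on by metis
  obtain x where x: "x \<in> X" using points_nonempty by blast
  have y: "f x \<in> X" using x fX by blast
  have "x' = x" if "(x', f x) \<in> t" for x'
  proof -
    have x': "x' \<in> X" using relation_points[OF tS(1) that] by simp
    then have "f x' = f x" using thin_functional[OF t f that] by simp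
    then show ?thesis using inj x x' by (simp add: inj_on_eq_iff)
  qed
  then have "t\<inverse> `` {f x} = {x}" using f[OF x] by blast
  then show ?thesis using thin_iff[OF tS(2) y] by simp
qed

lemma thin_inverse: "t \<in> T \<Longrightarrow> t\<inverse> O t = Id_on X" "t \<in> T \<Longrightarrow> t O t\<inverse> = Id_on X"
proof -
  have *: "t O t\<inverse> = Id_on X" if t: "t \<in> T" for t
    using thin_functional[OF thin_converse[OF t]] thin_total[OF t] relation_points[OF thin_mem[OF t]]
    by (auto simp: Id_on_iff) blast
  show "t \<in> T \<Longrightarrow> t O t\<inverse> = Id_on X" using * .
  show "t \<in> T \<Longrightarrow> t\<inverse> O t = Id_on X" using *[OF thin_converse] by simp
qed

lemma relcomp_identity:
  assumes "s \<in> S"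
  shows "s O Id_on X = s" "Id_on X O s = s"
  using relation_subset[OF assms] by auto

text \<open>Let \<open>u\<close> be the relation joining the ends of one path through
  \<open>s\<close> and \<open>t\<close>. Triangle transfer puts such a path under every pair of
  \<open>u\<close>. Conversely, transfer along \<open>s\<close> shows that the middle point of any
  path has some \<open>t\<close>-successor in relation \<open>u\<close> to the start, and it has
  only one \<open>t\<close>-successor.\<close>

lemma relcomp_thin:
  assumes s: "s \<in> S" and t: "t \<in> T"
  shows "s O t \<in> S"
proof -
  note tS = thin_mem[OF t]
  obtain x y where xy: "(x, y) \<in> s" using relation_nonempty[OF s] by blast
  obtain z where yz: "(y, z) \<in> t" using thin_total[OF t] relation_points[OF s xy] by blast
  obtain u where u: "u \<in> S" "(x, z) \<in> u"
    using relation_exists relation_points s xy tS yz by meson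
  have "s O t = u"
  proof (intro equalityI subrelI)
    fix x' z' assume "(x', z') \<in> s O t"
    then obtain y' where y': "(x', y') \<in> s" "(y', z') \<in> t" by blast
    from triangle_transfer[OF u(1) converse_mem[OF tS] s u(2) _ xy y'(1)] yz
    obtain z'' where "(x', z'') \<in> u" "(y', z'') \<in> t" by blast
    then show "(x', z') \<in> u" using thin_functional[OF t] y'(2) by blast
  next
    fix x' z' assume "(x', z') \<in> u"
    from triangle_transfer[OF s tS u(1) xy yz u(2) this]
    show "(x', z') \<in> s O t" by blast
  qed
  then show ?thesis using u by simp
qed

lemma thin_relcomp:
  assumes s: "s \<in> T" and t: "t \<in> T"
  shows "s O t \<in> T"
proof -
  obtain x where x: "x \<in> X" using points_nonempty by blast
  obtain y where y: "s `` {x} = {y}" using thin_image[OF s x] .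
  then have "y \<in> X" using relation_points[OF thin_mem[OF s]] by blast
  then obtain z where "t `` {y} = {z}" using thin_image[OF t] by blast
  then have "(s O t) `` {x} = {z}" using y by (simp add: relcomp_Image)
  then show ?thesis using thin_iff[OF relcomp_thin[OF thin_mem[OF s] t] x] by simp
qed

lemma equiv_thin: "equiv X (\<Union>T)"
proof (rule equivI)
  show "\<Union>T \<subseteq> X \<times> X" using relation_subset thin_mem by blast
  show "refl_on X (\<Union>T)" using identity_thin by (auto simp: refl_on_def)
  show "sym (\<Union>T)" using thin_converse by (meson UnionE UnionI converseI symI)
  show "trans (\<Union>T)" using thin_relcomp by (meson UnionE UnionI relcompI transI)
qed

section \<open>Stabilizers in the thin radical\<close>

text \<open>This is the subgroup \<open>H\<^sub>s\<close> of the overview: thin relations act on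
  \<open>S\<close> by composition on the right, since \<open>s O t\<close> is a single
  relation.\<close>

definition thin_stabilizer :: "('a \<times> 'a) set \<Rightarrow> ('a \<times> 'a) set set" where
  "thin_stabilizer s = {t \<in> T. s O t = s}"

text \<open>Both \<open>s O t\<close> and \<open>s\<close> are relations of the scheme, so the
  common pair \<open>(x, z)\<close> makes them equal; one path suffices as a test.\<close>

lemma thin_stabilizer_memI:
  assumes "s \<in> S" "t \<in> T" "(x, y) \<in> s" "(y, z) \<in> t" "(x, z) \<in> s"
  shows "t \<in> thin_stabilizer s"
  using relation_unique[OF relcomp_thin[OF assms(1,2)] assms(1)] assms
  by (auto simp: thin_stabilizer_def)

lemma thin_stabilizer_thin:
  assumes "t \<in> T"
  shows "thin_stabilizer t = {Id_on X}"
proof -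
  have "u = Id_on X" if "u \<in> thin_stabilizer t" for u
  proof -
    have u: "u \<in> T" "t O u = t" using that by (auto simp: thin_stabilizer_def)
    then have "(t\<inverse> O t) O u = t\<inverse> O t" by (simp add: O_assoc)
    then show ?thesis using thin_inverse(1)[OF assms] relcomp_identity(2)[OF thin_mem[OF u(1)]] by simp
  qed
  moreover have "Id_on X \<in> thin_stabilizer t"
    using identity_thin relcomp_identity(1)[OF thin_mem[OF assms]] by (simp add: thin_stabilizer_def)
  ultimately show ?thesis by blast
qed

text \<open>
  The sets \<open>xs \<inter> yT\<close> with \<open>y \<in> xs\<close> all have the same size, so the number of \<open>T\<close>-classes that
  meet \<open>xs\<close> divides \<open>n\<^sub>s\<close>. It is less than \<open>p\<close> unless \<open>s\<close> is thin, because \<open>xs\<close> then misses \<open>xT\<close>.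
\<close>

lemma converse_relcomp_subset_thin:
  assumes p: "prime p" and s: "s \<in> S" and val: "valency X s = p ^ k"
    and quot: "card (X // \<Union>T) = p"
  shows "s\<inverse> O s \<subseteq> \<Union>T"
proof (cases "s \<in> T")
  case True
  then show ?thesis using thin_inverse(1) identity_thin by auto
next
  case False
  let ?E = "\<Union>T"
  show ?thesis
  proof (rule subrelI)
    fix y z assume "(y, z) \<in> s\<inverse> O s"
    then obtain x where xy: "(x, y) \<in> s" and xz: "(x, z) \<in> s" by blast
    have x: "x \<in> X" using relation_points[OF s xy] by simp
    define Q where "Q = (\<lambda>y. ?E `` {y}) ` (s `` {x})"
    \<comment> \<open>Each thin \<open>t\<close> contributes the number of points reached from
      \<open>x\<close> by \<open>s\<close> and from \<open>y\<close> by \<open>t\<close>, a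
      structure constant over \<open>s\<close> and hence independent of \<open>y\<close>.\<close>
    have const: "card (?E `` {y} \<inter> s `` {x}) = (\<Sum>t\<in>T. structure_constant s (t\<inverse>) s)"
      if "(x, y) \<in> s" for y
    proof -
      have "card (?E `` {y} \<inter> s `` {x}) = (\<Sum>t\<in>T. card (t `` {y} \<inter> s `` {x}))"
        by (rule card_Image_Union) (use thin_mem in blast)
      also have "\<dots> = (\<Sum>t\<in>T. structure_constant s (t\<inverse>) s)"
        using structure_constant_eq[OF s converse_mem s that] thin_mem
        by (intro sum.cong) (auto simp: Int_commute)
      finally show ?thesis .
    qed
    have self: "y \<in> ?E `` {y}" if "(x, y) \<in> s" for y
      using equiv_class_self[OF equiv_thin] relation_points[OF s that] by blast
    have finQ: "finite Q" unfolding Q_def using finite_Image[OF s] by blast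
    have Qsub: "Q \<subseteq> X // ?E"
      unfolding Q_def using relation_points[OF s] by (auto intro: quotientI)
    have "s `` {x} = (\<Union>C\<in>Q. C \<inter> s `` {x})" unfolding Q_def using self by auto
    also have "card \<dots> = (\<Sum>C\<in>Q. card (C \<inter> s `` {x}))"
    proof (rule card_UN_disjoint[OF finQ])
      show "\<forall>C\<in>Q. finite (C \<inter> s `` {x})" using finite_Image[OF s] by blast
      show "\<forall>C\<in>Q. \<forall>C'\<in>Q. C \<noteq> C' \<longrightarrow> C \<inter> s `` {x} \<inter> (C' \<inter> s `` {x}) = {}"
        using quotient_disj[OF equiv_thin] Qsub by blast
    qed
    also have "\<dots> = (\<Sum>C\<in>Q. \<Sum>t\<in>T. structure_constant s (t\<inverse>) s)"
      using const by (intro sum.cong) (auto simp: Q_def)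
    also have "\<dots> = card Q * (\<Sum>t\<in>T. structure_constant s (t\<inverse>) s)" by simp
    finally have "card Q dvd p ^ k" using valency_eq_card[OF s x] val by simp
    then obtain j where j: "card Q = p ^ j" using p divides_primepow_nat by blast
    \<comment> \<open>A point of \<open>xs\<close> in the class of \<open>x\<close> would be joined
      to \<open>x\<close> by a thin relation, which would have to be \<open>s\<close>.\<close>
    have "?E `` {x} \<notin> Q"
    proof
      assume "?E `` {x} \<in> Q"
      then obtain w where w: "(x, w) \<in> s" "?E `` {x} = ?E `` {w}" by (auto simp: Q_def)
      then obtain t where "t \<in> T" "(x, w) \<in> t" using self by blast
      then show False using relation_unique[OF s thin_mem w(1)] False by blast
    qed
    then have "Q \<subset> X // ?E" using Qsub quotientI[OF x] by blast
    then have "card Q < p"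
      using psubset_card_mono[OF finite_quotient[OF finite_points]] equiv_type[OF equiv_thin] quot
      by blast
    then have "p ^ j < p ^ 1" using j by simp
    then have "j = 0" using power_less_imp_less_exp[OF prime_gt_1_nat[OF p]] by blast
    then have "card Q = 1" using j by simp
    moreover have "?E `` {y} \<in> Q" "?E `` {z} \<in> Q" using xy xz by (auto simp: Q_def)
    ultimately have "?E `` {y} = ?E `` {z}" by (metis card_1_singletonE singletonD)
    then show "(y, z) \<in> ?E" using self[OF xz] by blast
  qed
qed

end

section \<open>Consequences of commutativity\<close>

locale commutative_association_scheme = association_scheme +
  assumes commute: "s \<in> S \<Longrightarrow> t \<in> S \<Longrightarrow> u \<in> S \<Longrightarrow>
    structure_constant s t u = structure_constant t s u"
begin

text \<open>A pair lies in \<open>s O t\<close> exactly when the structure constant of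
  \<open>s\<close>, \<open>t\<close> over its relation is nonzero, and that constant is symmetric in
  \<open>s\<close> and \<open>t\<close>.\<close>

lemma relcomp_commute:
  assumes s: "s \<in> S" and t: "t \<in> S"
  shows "s O t = t O s"
proof -
  have sub: "s O t \<subseteq> t O s" if s: "s \<in> S" and t: "t \<in> S" for s t
  proof (rule subrelI)
    fix x z assume "(x, z) \<in> s O t"
    then obtain y where y: "(x, y) \<in> s" "(y, z) \<in> t" by blast
    obtain u where u: "u \<in> S" "(x, z) \<in> u"
      using relation_exists relation_points s t y by meson
    have "card (t `` {x} \<inter> s\<inverse> `` {z}) = card (s `` {x} \<inter> t\<inverse> `` {z})"
      using structure_constant_eq s t u commute by metis
    moreover have "card (s `` {x} \<inter> t\<inverse> `` {z}) \<noteq> 0"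
      using y finite_Image[OF s] by auto
    ultimately have "t `` {x} \<inter> s\<inverse> `` {z} \<noteq> {}" by (metis card.empty)
    then show "(x, z) \<in> t O s" by blast
  qed
  show ?thesis using sub[OF s t] sub[OF t s] by blast
qed

text \<open>The path from \<open>x\<close> by \<open>s\<close> and then \<open>t\<close> ends in
  \<open>y'\<close>. Commuting the product gives a path to \<open>y'\<close> that begins with
  \<open>t\<close>, and its first step can only lead to \<open>x'\<close>.\<close>

lemma thin_automorphism:
  assumes "s \<in> S" "t \<in> T" "(x, y) \<in> s" "(x, x') \<in> t" "(y, y') \<in> t"
  shows "(x', y') \<in> s"
proof -
  have "(x, y') \<in> t O s" using relcomp_commute[OF assms(1) thin_mem[OF assms(2)]] assms by blast
  then show ?thesis using thin_functional[OF assms(2)] assms by blast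
qed

text \<open>Taking converses turns right composition with \<open>t\<close> into left composition
  with its converse; commutativity moves this factor back to the right, where it cancels against
  \<open>t\<close>.\<close>

lemma thin_stabilizer_converse:
  assumes "s \<in> S"
  shows "thin_stabilizer (s\<inverse>) = thin_stabilizer s"
proof -
  have sub: "thin_stabilizer (s\<inverse>) \<subseteq> thin_stabilizer s" if s: "s \<in> S" for s
  proof
    fix t assume "t \<in> thin_stabilizer (s\<inverse>)"
    then have t: "t \<in> T" "s\<inverse> O t = s\<inverse>" by (auto simp: thin_stabilizer_def)
    then have "t\<inverse> O s = s" by (metis converse_converse converse_relcomp)
    then have "s = s O t\<inverse>"
      using relcomp_commute[OF s thin_mem[OF thin_converse[OF t(1)]]] by simp
    then have "s O t = s O (t\<inverse> O t)" by (metis O_assoc)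
    then show "t \<in> thin_stabilizer s"
      using t thin_inverse(1) relcomp_identity(1)[OF s] by (simp add: thin_stabilizer_def)
  qed
  show ?thesis using sub[OF assms] sub[OF converse_mem[OF assms]] by simp
qed

text \<open>Moving \<open>z\<close> to \<open>z'\<close> along \<open>t\<close> keeps the side from
  \<open>x\<close> in \<open>w\<close>, so some triangle with middle point \<open>y'\<close> lies
  over it. As \<open>y\<close> and \<open>y'\<close> both lie in \<open>xu\<close>, a thin
  \<open>h\<close> links them. Being an automorphism, \<open>h\<close> takes \<open>z\<close> to a
  point \<open>z''\<close> that has, like \<open>z'\<close>, relation \<open>v\<close> from
  \<open>y'\<close>; so a thin \<open>k\<close> links \<open>z''\<close> to \<open>z'\<close>. Both
  \<open>t\<close> and \<open>h O k\<close> contain \<open>(z, z')\<close>.\<close>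

lemma thin_stabilizer_triangle:
  assumes sub: "\<And>s. s \<in> S \<Longrightarrow> s\<inverse> O s \<subseteq> \<Union>T"
    and S: "u \<in> S" "v \<in> S" "w \<in> S"
    and tri: "(x, y) \<in> u" "(y, z) \<in> v" "(x, z) \<in> w"
    and t: "t \<in> thin_stabilizer w"
  shows "\<exists>h\<in>thin_stabilizer u. \<exists>k\<in>thin_stabilizer v. t = h O k"
proof -
  have tT: "t \<in> T" and wt: "w O t = w" using t by (auto simp: thin_stabilizer_def)
  obtain z' where z': "(z, z') \<in> t"
    using thin_total[OF tT] relation_points[OF S(3) tri(3)] by blast
  then have "(x, z') \<in> w" using tri(3) wt by blast
  from triangle_transfer[OF S tri this]
  obtain y' where y': "(x, y') \<in> u" "(y', z') \<in> v" by blast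
  then have "(y, y') \<in> \<Union>T" using sub[OF S(1)] tri(1) by blast
  then obtain h where h: "h \<in> T" "(y, y') \<in> h" by blast
  obtain z'' where z'': "(z, z'') \<in> h"
    using thin_total[OF h(1)] relation_points[OF S(2) tri(2)] by blast
  have y'z'': "(y', z'') \<in> v" using thin_automorphism[OF S(2) h(1) tri(2) h(2) z''] .
  then have "(z'', z') \<in> \<Union>T" using sub[OF S(2)] y'(2) by blast
  then obtain k where k: "k \<in> T" "(z'', z') \<in> k" by blast
  have "h \<in> thin_stabilizer u" using thin_stabilizer_memI[OF S(1) h(1) tri(1) h(2) y'(1)] .
  moreover have "k \<in> thin_stabilizer v" using thin_stabilizer_memI[OF S(2) k(1) y'z'' k(2) y'(2)] .
  moreover have "t = h O k"
    using relation_unique[OF thin_mem[OF tT] thin_mem[OF thin_relcomp[OF h(1) k(1)]] z'] z'' k(2)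
    by blast
  ultimately show ?thesis by blast
qed

text \<open>
  The relations \<open>u\<close> with \<open>thin_stabilizer u \<subseteq> thin_stabilizer s\<close> form a closed subset that
  contains \<open>s\<close> and the thin radical, which is maximal among the proper closed subsets.
\<close>

lemma thin_stabilizer_subset:
  assumes p: "prime p" and ord: "card X = p ^ Suc m" and thin: "scheme_order X T = p ^ m"
    and sub: "\<And>s. s \<in> S \<Longrightarrow> s\<inverse> O s \<subseteq> \<Union>T"
    and s: "s \<in> S - T" and u: "u \<in> S"
  shows "thin_stabilizer u \<subseteq> thin_stabilizer s"
proof -
  define D where "D = {u \<in> S. thin_stabilizer u \<subseteq> thin_stabilizer s}"
  have D: "D \<subseteq> S" by (auto simp: D_def)
  have "Id_on X \<in> thin_stabilizer s"
    using identity_thin relcomp_identity(1) s by (simp add: thin_stabilizer_def)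
  then have TD: "T \<subseteq> D" using thin_stabilizer_thin thin_mem by (auto simp: D_def)
  have eq: "equiv X (\<Union>D)"
  proof (rule equivI)
    show "\<Union>D \<subseteq> X \<times> X" using D relation_subset by blast
    show "refl_on X (\<Union>D)" using TD identity_thin by (auto simp: refl_on_def)
    show "sym (\<Union>D)"
    proof (rule symI)
      fix x y assume "(x, y) \<in> \<Union>D"
      then obtain v where "v \<in> D" "(x, y) \<in> v" by blast
      moreover from this have "v\<inverse> \<in> D" using thin_stabilizer_converse converse_mem by (simp add: D_def)
      ultimately show "(y, x) \<in> \<Union>D" by blast
    qed
    show "trans (\<Union>D)"
    proof (rule transI)
      fix x y z assume "(x, y) \<in> \<Union>D" "(y, z) \<in> \<Union>D"
      then obtain v w where vw: "v \<in> D" "w \<in> D" "(x, y) \<in> v" "(y, z) \<in> w" by blast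
      then obtain r where r: "r \<in> S" "(x, z) \<in> r"
        using relation_exists relation_points D by (meson subsetD)
      \<comment> \<open>An element stabilizing \<open>r\<close> is a product of elements stabilizing
        \<open>v\<close> and \<open>w\<close>, and each of these factors fixes
        \<open>s\<close>.\<close>
      have "t \<in> thin_stabilizer s" if t: "t \<in> thin_stabilizer r" for t
      proof -
        obtain h k where "h \<in> thin_stabilizer v" "k \<in> thin_stabilizer w" and hk: "t = h O k"
          using thin_stabilizer_triangle[OF sub _ _ r(1) vw(3,4) r(2) t] vw D by blast
        then have "s O h = s" "s O k = s" "h \<in> T" "k \<in> T"
          using vw unfolding D_def thin_stabilizer_def by blast+
        then show ?thesis
          using hk thin_relcomp by (simp add: thin_stabilizer_def O_assoc[symmetric])
      qed
      then show "(x, z) \<in> \<Union>D" using r by (auto simp: D_def)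
    qed
  qed
  obtain x where x: "x \<in> X" using points_nonempty by blast
  obtain y where y: "(x, y) \<in> s" using relation_total s x by blast
  have "y \<notin> (\<Union>T) `` {x}"
    using relation_unique[OF _ thin_mem y] s by blast
  moreover have "y \<in> (\<Union>D) `` {x}" using s y by (auto simp: D_def)
  ultimately have "(\<Union>T) `` {x} \<subset> (\<Union>D) `` {x}" using TD by blast
  moreover have "finite ((\<Union>D) `` {x})"
    using equiv_type[OF eq] by (rule finite_subset[OF Image_subset finite_points])
  ultimately have less: "p ^ m < scheme_order X D"
    using psubset_card_mono card_Image_Union_eq_scheme_order[OF D x]
      card_Image_Union_eq_scheme_order[of T, OF _ x] thin thin_mem by (metis subsetI)
  \<comment> \<open>The order of \<open>D\<close> is a power of \<open>p\<close> that divides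
    \<open>p ^ Suc m\<close> and exceeds \<open>p ^ m\<close>. So a single class of \<open>D\<close>
    is all of \<open>X\<close>, and every relation belongs to \<open>D\<close>.\<close>
  have "scheme_order X D dvd p ^ Suc m"
    using scheme_order_mult_card_quotient[OF D eq] ord by (metis dvd_triv_left)
  then obtain j where j: "j \<le> Suc m" "scheme_order X D = p ^ j"
    using p divides_primepow_nat by blast
  then have "m < j" using less power_less_imp_less_exp[OF prime_gt_1_nat[OF p]] by metis
  then have "j = Suc m" using j by simp
  then have "card ((\<Union>D) `` {x}) = card X"
    using j ord card_Image_Union_eq_scheme_order[OF D x] by simp
  moreover have "(\<Union>D) `` {x} \<subseteq> X" using equiv_type[OF eq] by blast
  ultimately have full: "(\<Union>D) `` {x} = X" using finite_points card_subset_eq by blast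
  obtain z where z: "(x, z) \<in> u" using relation_total u x by blast
  then have "z \<in> (\<Union>D) `` {x}" using full relation_points[OF u] by blast
  then obtain v where "v \<in> D" "(x, z) \<in> v" by blast
  then have "u = v" using relation_unique[OF u _ z] D by blast
  then show ?thesis using \<open>v \<in> D\<close> by (simp add: D_def)
qed

section \<open>Construction of automorphisms\<close>

text \<open>Transfer yields a point \<open>v\<close> with the required relations to
  \<open>x'\<close> and \<open>z'\<close>. Since \<open>v\<close> and \<open>w'\<close> both lie in
  \<open>x'b\<close>, they differ by an element of the stabilizer of \<open>b\<close>. As
  \<open>c\<close> is not thin, this element also fixes \<open>c\<close>, so \<open>v\<close> may be
  replaced by \<open>w'\<close>.\<close>

lemma relation_determined:
  assumes sub: "\<And>s. s \<in> S \<Longrightarrow> s\<inverse> O s \<subseteq> \<Union>T"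
    and stab: "\<And>s u. s \<in> S - T \<Longrightarrow> u \<in> S \<Longrightarrow> thin_stabilizer u \<subseteq> thin_stabilizer s"
    and S: "a \<in> S" "b \<in> S" "c \<in> S - T"
    and xzw: "(x, z) \<in> a" "(x, w) \<in> b" "(z, w) \<in> c"
    and xzw': "(x', z') \<in> a" "(x', w') \<in> b"
  shows "(z', w') \<in> c"
proof -
  have cS: "c \<in> S" using S by simp
  have "(w, z) \<in> c\<inverse>" using xzw(3) by simp
  from triangle_transfer[OF S(2) converse_mem[OF cS] S(1) xzw(2) this xzw(1) xzw'(1)]
  obtain v where v: "(x', v) \<in> b" "(z', v) \<in> c" by blast
  then have "(v, w') \<in> \<Union>T" using sub[OF S(2)] xzw'(2) by blast
  then obtain h where h: "h \<in> T" "(v, w') \<in> h" by blast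
  have "h \<in> thin_stabilizer b" using thin_stabilizer_memI[OF S(2) h(1) v(1) h(2) xzw'(2)] .
  then have "c O h = c" using stab[OF S(3) S(2)] by (auto simp: thin_stabilizer_def)
  then show ?thesis using v(2) h(2) by blast
qed

text \<open>
  The automorphism is prescribed on one representative of each \<open>T\<close>-class, with \<open>x\<close> and, where
  possible, \<open>y\<close> among them, and extended so as to commute with the thin relations.
\<close>

lemma exists_automorphism:
  assumes sub: "\<And>s. s \<in> S \<Longrightarrow> s\<inverse> O s \<subseteq> \<Union>T"
    and stab: "\<And>s u. s \<in> S - T \<Longrightarrow> u \<in> S \<Longrightarrow> thin_stabilizer u \<subseteq> thin_stabilizer s"
    and s: "s \<in> S" and xy: "(x, y) \<in> s" and xy': "(x', y') \<in> s"
  obtains g where "g x = x'" "g y = y'"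
    and "\<And>u z w. u \<in> S \<Longrightarrow> (z, w) \<in> u \<Longrightarrow> (g z, g w) \<in> u"
proof -
  define E where "E = \<Union>T"
  have equiv: "equiv X E" using equiv_thin by (simp add: E_def)
  have X: "x \<in> X" "y \<in> X" "x' \<in> X" "y' \<in> X" using relation_points[OF s] xy xy' by auto
  obtain r where r: "r z w \<in> S" "(z, w) \<in> r z w" if "z \<in> X" "w \<in> X" for z w
    using relation_exists by metis
  have r_eq: "r z w = u" if u: "u \<in> S" and zw: "(z, w) \<in> u" for u z w
    using relation_unique[OF r(1) u r(2) zw] relation_points[OF u zw] by simp
  have r_diag: "r z z = Id_on X" if "z \<in> X" for z
    using r_eq[OF identity_mem] that by blast
  have rE: "r z w \<in> T" if "(z, w) \<in> E" for z w
    using that r_eq thin_mem unfolding E_def by blast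
  \<comment> \<open>The choice by \<open>SOME\<close> depends on \<open>z\<close> only through its
    class, so \<open>q\<close> is constant on classes. A class containing both \<open>x\<close> and
    \<open>y\<close> is represented by \<open>x\<close>.\<close>
  define q where "q z = (if (x, z) \<in> E then x else if (y, z) \<in> E then y
     else (SOME w. w \<in> E `` {z}))" for z
  \<comment> \<open>Only values at representatives are used. Each value has the same relation to
    \<open>x'\<close> as its argument has to \<open>x\<close>, which lets
    \<open>relation_determined\<close> apply.\<close>
  define f where "f z = (if z = x then x' else if z = y then y'
     else (SOME z'. (x', z') \<in> r x z))" for z
  \<comment> \<open>A thin relation leads from \<open>q z\<close> to \<open>z\<close>; the same
    relation leads from \<open>f (q z)\<close> to \<open>g z\<close>.\<close>
  define g where "g z = (SOME z'. (f (q z), z') \<in> r (q z) z)" for z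
  have sym: "(w, z) \<in> E" if "(z, w) \<in> E" for z w
    using equiv that by (meson Equiv_Relations.equivE symD)
  have trans: "(u, w) \<in> E" if "(u, v) \<in> E" "(v, w) \<in> E" for u v w
    using equiv that by (meson Equiv_Relations.equivE transD)
  have refl: "(z, z) \<in> E" if "z \<in> X" for z
    using equiv that by (meson Equiv_Relations.equivE refl_onD)
  have qE: "(q z, z) \<in> E" if z: "z \<in> X" for z
  proof -
    have "(SOME w. w \<in> E `` {z}) \<in> E `` {z}" by (rule someI[of _ z]) (simp add: refl[OF z])
    then have "(SOME w. w \<in> E `` {z}, z) \<in> E" unfolding Image_singleton_iff by (rule sym)
    then show ?thesis by (simp only: q_def split: if_split) blast
  qed
  have qX: "q z \<in> X" if "z \<in> X" for z
    using qE[OF that] equiv_type[OF equiv] by blast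
  have q_eq: "q z = q w" if zw: "(z, w) \<in> E" for z w
  proof -
    have "(u, z) \<in> E \<longleftrightarrow> (u, w) \<in> E" for u using trans sym zw by blast
    moreover have "E `` {z} = E `` {w}" using equiv_class_eq[OF equiv zw] .
    ultimately show ?thesis unfolding q_def by simp
  qed
  have q_not: "(q z, q w) \<notin> E" if "z \<in> X" "w \<in> X" "q z \<noteq> q w" for z w
    using q_eq that qE sym trans by meson
  have f: "(x', f z) \<in> r x z" if z: "z \<in> X" for z
  proof -
    have "(x', SOME z'. (x', z') \<in> r x z) \<in> r x z"
      using someI_ex[OF relation_total[OF r(1) X(3)]] X z by simp
    then show ?thesis unfolding f_def using X xy' r_eq[OF s xy] r_diag by auto
  qed
  have fX: "f z \<in> X" if "z \<in> X" for z
    using relation_points[OF r(1) f] that X by blast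
  have g: "(f (q z), g z) \<in> r (q z) z" if z: "z \<in> X" for z
    unfolding g_def using someI_ex[OF relation_total[OF r(1) fX]] qX z by simp
  have mid: "\<exists>c\<in>S. (q z, q w) \<in> c \<and> (f (q z), f (q w)) \<in> c" if zw: "z \<in> X" "w \<in> X" for z w
  proof (cases "q z = q w")
    case True
    then show ?thesis using identity_mem qX fX zw by (metis Id_onI)
  next
    case False
    let ?c = "r (q z) (q w)"
    have c: "?c \<in> S" "(q z, q w) \<in> ?c" using r qX zw by auto
    \<comment> \<open>Distinct representatives lie in different classes, so their relation is not
      thin and is determined by their relations to \<open>x\<close>.\<close>
    have "?c \<notin> T" using q_not[OF zw False] c(2) by (auto simp: E_def)
    then have cT: "?c \<in> S - T" using c(1) by simp
    note q' = qX[OF zw(1)] qX[OF zw(2)]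
    have "(f (q z), f (q w)) \<in> ?c"
      by (rule relation_determined[OF sub stab r(1) r(1) cT r(2) r(2) c(2) f f])
        (simp_all add: X q')
    then show ?thesis using c by blast
  qed
  have pres: "(g z, g w) \<in> u" if u: "u \<in> S" and zw: "(z, w) \<in> u" for u z w
  proof -
    note mem = relation_points[OF u zw]
    \<comment> \<open>The path \<open>z\<close>, \<open>q z\<close>, \<open>q w\<close>,
      \<open>w\<close> and the path \<open>g z\<close>, \<open>f (q z)\<close>,
      \<open>f (q w)\<close>, \<open>g w\<close> run through the same relations. Their composite is
      a single relation, hence \<open>u\<close>; to see this, commutativity moves the thin factor on
      the left to the right.\<close>
    let ?t = "r (q z) z" and ?v = "r (q w) w"
    have tv: "?t \<in> T" "?v \<in> T" using rE qE mem by auto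
    obtain c where c: "c \<in> S" "(q z, q w) \<in> c" "(f (q z), f (q w)) \<in> c" using mid mem by blast
    have S': "c O ?v \<in> S" using relcomp_thin[OF c(1) tv(2)] .
    have comm: "?t\<inverse> O (c O ?v) = (c O ?v) O ?t\<inverse>"
      using relcomp_commute[OF converse_mem[OF thin_mem[OF tv(1)]] S'] .
    have S'': "?t\<inverse> O (c O ?v) \<in> S"
      unfolding comm by (rule relcomp_thin[OF S' thin_converse[OF tv(1)]])
    have "(z, w) \<in> ?t\<inverse> O (c O ?v)"
      using c(2) r(2) qX mem by (meson converseI relcompI)
    then have "u = ?t\<inverse> O (c O ?v)" using relation_unique[OF u S'' zw] by simp
    moreover have "(g z, g w) \<in> ?t\<inverse> O (c O ?v)"
      using c(3) g mem by (meson converseI relcompI)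
    ultimately show ?thesis by (simp only:)
  qed
  have qx: "q x = x" using refl[OF X(1)] by (simp add: q_def)
  have gx: "g x = x'" using g[OF X(1)] qx r_diag[OF X(1)] by (auto simp: f_def)
  \<comment> \<open>If \<open>y\<close> lies in the class of \<open>x\<close>, its image is computed
    from \<open>x\<close>; but then \<open>s\<close> is thin, and \<open>y'\<close> is the only
    point that \<open>s\<close> reaches from \<open>x'\<close>.\<close>
  have gy: "g y = y'"
  proof (cases "(x, y) \<in> E")
    case True
    then have "s \<in> T" using rE r_eq[OF s xy] by blast
    moreover have "(x', y') \<in> s" "(x', g y) \<in> s"
      using pres[OF s xy] gx xy' by auto
    ultimately show ?thesis using thin_functional by blast
  next
    case False
    then have "y \<noteq> x" using refl X by blast
    moreover have "q y = y" using False refl[OF X(2)] by (simp add: q_def)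
    ultimately show ?thesis using g[OF X(2)] r_diag[OF X(2)] by (auto simp: f_def)
  qed
  show thesis using that gx gy pres by blast
qed

section \<open>The automorphism group and its orbits on pairs\<close>

text \<open>Members of \<open>Bij X\<close> are \<open>undefined\<close> outside \<open>X\<close>,
  so the condition is restricted to points of \<open>X\<close>. The equivalence, rather than an
  implication, gives closure under inverses directly.\<close>

definition automorphisms :: "('a \<Rightarrow> 'a) set" where
  "automorphisms = {g \<in> Bij X. \<forall>u\<in>S. \<forall>z\<in>X. \<forall>w\<in>X. (g z, g w) \<in> u \<longleftrightarrow> (z, w) \<in> u}"

lemma automorphisms_subgroup: "subgroup automorphisms (BijGroup X)"
proof -
  interpret group "BijGroup X" by (rule group_BijGroup)
  show ?thesis
  proof
    show "automorphisms \<subseteq> carrier (BijGroup X)"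
      by (auto simp: automorphisms_def BijGroup_def)
    show "\<one>\<^bsub>BijGroup X\<^esub> \<in> automorphisms"
      by (auto simp: automorphisms_def BijGroup_def id_Bij)
    fix g assume g: "g \<in> automorphisms"
    then have gB: "g \<in> Bij X" by (simp add: automorphisms_def)
    have "(inv_into X g z, inv_into X g w) \<in> u \<longleftrightarrow> (z, w) \<in> u"
      if "u \<in> S" "z \<in> X" "w \<in> X" for u z w
    proof -
      have "g ` X = X" using gB by (simp add: Bij_def bij_betw_def)
      then have "inv_into X g z \<in> X" "inv_into X g w \<in> X"
        "g (inv_into X g z) = z" "g (inv_into X g w) = w"
        using that by (auto simp: inv_into_into f_inv_into_f)
      then show ?thesis using g that(1) unfolding automorphisms_def by force
    qed
    then show "inv\<^bsub>BijGroup X\<^esub> g \<in> automorphisms"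
      using inv_BijGroup[OF gB] restrict_inv_into_Bij[OF gB] by (simp add: automorphisms_def)
    fix h assume h: "h \<in> automorphisms"
    then have hB: "h \<in> Bij X" by (simp add: automorphisms_def)
    then have "h z \<in> X" if "z \<in> X" for z using that by (auto simp: Bij_def bij_betw_def)
    then show "g \<otimes>\<^bsub>BijGroup X\<^esub> h \<in> automorphisms"
      using g h compose_Bij[OF gB hB] by (simp add: automorphisms_def BijGroup_def compose_eq)
  qed
qed

text \<open>Preservation in one direction suffices: the relations partition all pairs, so a pair
  mapped into \<open>u\<close> must come from \<open>u\<close>. Applied to the identity relation
  this gives injectivity, and finiteness of \<open>X\<close> gives surjectivity.\<close>

lemma automorphismI:
  assumes g: "\<And>u z w. u \<in> S \<Longrightarrow> (z, w) \<in> u \<Longrightarrow> (g z, g w) \<in> u"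
  shows "restrict g X \<in> automorphisms"
proof -
  have into: "g z \<in> X" if "z \<in> X" for z
    using g[OF identity_mem, of z z] that by auto
  have iff: "(g z, g w) \<in> u \<longleftrightarrow> (z, w) \<in> u" if u: "u \<in> S" and zw: "z \<in> X" "w \<in> X" for u z w
    using relation_exists[OF zw] relation_unique[OF u] g by metis
  have "inj_on g X"
  proof (rule inj_onI)
    fix z w assume zw: "z \<in> X" "w \<in> X" "g z = g w"
    then have "(g z, g w) \<in> Id_on X" using into by auto
    then show "z = w" using iff[OF identity_mem zw(1,2)] by auto
  qed
  then have "bij_betw g X X"
    using into finite_points endo_inj_surj by (metis bij_betw_def image_subsetI)
  then have "restrict g X \<in> Bij X" by (simp add: Bij_def bij_betw_restrict_eq)
  then show ?thesis using iff by (simp add: automorphisms_def)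
qed

text \<open>Automorphisms preserve each relation, so transitivity makes it exactly one orbit on
  pairs. The identity relation yields transitivity on points.\<close>

lemma schurian_if_transitive_on_relations:
  assumes trans: "\<And>s x y x' y'. s \<in> S \<Longrightarrow> (x, y) \<in> s \<Longrightarrow> (x', y') \<in> s \<Longrightarrow>
    \<exists>g\<in>automorphisms. g x = x' \<and> g y = y'"
  shows "schurian X S"
proof -
  have orbit: "s = {(g x, g y) | g. g \<in> automorphisms}" if s: "s \<in> S" and xy: "(x, y) \<in> s"
    for s x y
  proof (intro equalityI subrelI)
    fix z w assume "(z, w) \<in> s"
    then show "(z, w) \<in> {(g x, g y) | g. g \<in> automorphisms}" using trans[OF s xy] by blast
  next
    fix z w assume "(z, w) \<in> {(g x, g y) | g. g \<in> automorphisms}"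
    then show "(z, w) \<in> s" using s xy relation_points[OF s xy] by (auto simp: automorphisms_def)
  qed
  have "S = {{(g x, g y) | g. g \<in> automorphisms} | x y. x \<in> X \<and> y \<in> X}" (is "_ = ?O")
  proof (intro equalityI subsetI)
    fix s assume s: "s \<in> S"
    obtain x y where xy: "(x, y) \<in> s" using relation_nonempty[OF s] by blast
    show "s \<in> ?O" using orbit[OF s xy] relation_points[OF s xy] by blast
  next
    fix s assume "s \<in> ?O"
    then obtain x y where "x \<in> X" "y \<in> X" and "s = {(g x, g y) | g. g \<in> automorphisms}" by blast
    moreover from this obtain u where "u \<in> S" "(x, y) \<in> u" using relation_exists by blast
    ultimately show "s \<in> S" using orbit[of u x y] by simp
  qed
  moreover have "\<exists>g\<in>automorphisms. g x = y" if "x \<in> X" "y \<in> X" for x y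
    using trans[OF identity_mem, of x x y y] that by blast
  ultimately show ?thesis
    unfolding schurian_iff using automorphisms_subgroup by (intro exI[of _ automorphisms]) blast
qed

end

theorem theorem3p5:
  fixes p n :: nat and X :: "'a set" and S :: "('a \<times> 'a) set set"
  assumes "prime p" and "odd p" and "n > 0"
    and "commutative_scheme X S"
    and "p_scheme p X S"
    and "scheme_order X S = p ^ n"
    and "scheme_order X (thin_radical X S) = p ^ (n - 1)"
  shows "schurian X S"
proof -
  interpret commutative_association_scheme X S
    using assms(4)
    by (auto simp: commutative_scheme_def commutative_association_scheme_def
        commutative_association_scheme_axioms_def)
  obtain m where m: "n = Suc m" using assms(3) gr0_implies_Suc by blast
  have ord: "card X = p ^ Suc m" using assms(6) m scheme_order_eq_card by simp
  have thin: "scheme_order X T = p ^ m" using assms(7) m by simp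
  \<comment> \<open>Every class of the thin radical has \<open>p ^ m\<close> of the
    \<open>p ^ Suc m\<close> points, which leaves \<open>p\<close> classes.\<close>
  have "p ^ m * card (X // \<Union>T) = p ^ m * p"
    using scheme_order_mult_card_quotient[OF _ equiv_thin] thin thin_mem ord
    by (metis mult.commute power_Suc subsetI)
  then have quot: "card (X // \<Union>T) = p" using prime_gt_0_nat[OF assms(1)] by simp
  have sub: "s\<inverse> O s \<subseteq> \<Union>T" if s: "s \<in> S" for s
  proof -
    obtain k where "valency X s = p ^ k" using assms(5) s by (auto simp: p_scheme_def)
    then show ?thesis using converse_relcomp_subset_thin[OF assms(1) s _ quot] by blast
  qed
  have stab: "thin_stabilizer u \<subseteq> thin_stabilizer s" if "s \<in> S - T" "u \<in> S" for s u
    using thin_stabilizer_subset[OF assms(1) ord thin sub that] .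
  show ?thesis
  proof (rule schurian_if_transitive_on_relations)
    fix s x y x' y' assume s: "s \<in> S" and xy: "(x, y) \<in> s" "(x', y') \<in> s"
    obtain g where "g x = x'" "g y = y'"
      and "\<And>u z w. u \<in> S \<Longrightarrow> (z, w) \<in> u \<Longrightarrow> (g z, g w) \<in> u"
      using exists_automorphism[OF sub stab s xy] by blast
    then show "\<exists>g\<in>automorphisms. g x = x' \<and> g y = y'"
      using automorphismI relation_points[OF s xy(1)] by (metis restrict_apply')
  qed
qed

end
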